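(* Let $n\ge1$, let $A$ be the adjacency matrix of the hypercube $Q_n$, let $a,b$ be a pair of antipodal vertices of $Q_n$, and let $d$ be the symmetrized divisor matrix of the distance partition of $Q_n$ from $a$. Let $A'$ be any square matrix whose index set admits a partition, with normalized indicator matrix $P'$, such that $A'P'=P'd$, where the parts corresponding to the parts $\{a\}$ and $\{b\}$ of the distance partition are singletons, also denoted $\{a\}$ and $\{b\}$. Then $\mathcal{R}(\lambda,\{a,b\},A)=\mathcal{R}(\lambda,\{a,b\},A')$, the restrictions of $e^{-itA}$ and $e^{-itA'}$ to rows and columns $\{a,b\}$ are equal for all $t$, and $A'$ exhibits perfect state transfer between $a$ and $b$ at time $t=\frac{\pi}{2}$.
   Context: The hypercube $Q_n$ is the graph on $\{0,1\}^n$ with two vertices adjacent iff they differ in exactly one coordinate; $a$ and $b$ are antipodal if they differ in all coordinates. The distance partition of $Q_n$ from $a$ is $(V_0,\dots,V_n)$ with $V_j$ the set of vertices at distance $j$ from $a$; thus $V_0=\{a\}$, $V_n=\{b\}$. The normalized indicator matrix of a partition is the matrix whose columns are the indicator vectors of the parts, each divided by its Euclidean norm. If $P$ is the normalized indicator matrix of the distance partition then $AP=Pd$ with $d=P^TAP$, which is called the symmetrized divisor matrix. For a matrix $B=\begin{bmatrix} M & C \\ D & F \end{bmatrix}$ with the $M$ block indexed by $S$, $\mathcal{R}(\lambda,S,B)=M+C(\lambda I-F)^{-1}D$, a matrix of rational functions in $\lambda$. Perfect state transfer between $a$ and $b$ at time $\tau$ for a matrix $B$ means $e^{-i\tau B}e_a=\gamma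 e_b$ for some complex $\gamma$ with $|\gamma|=1$ (and likewise with $a$ and $b$ exchanged), where $e_x$ is the standard basis vector indexed by $x$. *)

theory Defs
  imports
    Complex_Main
    "HOL-Library.Disjoint_Sets"
    "HOL-Computational_Algebra.Normalized_Fraction"
    "HOL-Computational_Algebra.Polynomial_Factorial"
    "Jordan_Normal_Form.Gauss_Jordan_Elimination"
begin

text \<open>
  Index sets of matrices are initial segments of the natural numbers. A vertex of the
  hypercube, that is a 0/1-vector of length \<open>n\<close>, is represented by the number below \<open>2 ^ n\<close>
  whose binary digits are its coordinates: coordinate \<open>i\<close> of \<open>u\<close> is \<open>bit u i\<close> (\<open>i < n\<close>).
\<close>

definition cube_edges :: "nat \<Rightarrow> (nat \<times> nat) set" where
  "cube_edges n = {(u, v). u < 2 ^ n \<and> v < 2 ^ n \<and> (\<exists>!i. i < n \<and> bit u i \<noteq> bit v i)}"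

definition antipodal :: "nat \<Rightarrow> nat \<Rightarrow> nat \<Rightarrow> bool" where
  "antipodal n a b \<longleftrightarrow> (\<forall>i<n. bit a i \<noteq> bit b i)"

definition adjacency_matrix :: "nat \<Rightarrow> (nat \<times> nat) set \<Rightarrow> complex mat" where
  "adjacency_matrix N E = mat N N (\<lambda>(u, v). if (u, v) \<in> E then 1 else 0)"

abbreviation cube_matrix :: "nat \<Rightarrow> complex mat" where
  "cube_matrix n \<equiv> adjacency_matrix (2 ^ n) (cube_edges n)"

text \<open>
  Length of a shortest walk, since \<open>E ^^ k\<close> relates the endpoints of the walks of length \<open>k\<close>;
  only meaningful for vertices in the same component (hypercubes are connected).
\<close>

definition graph_dist :: "(nat \<times> nat) set \<Rightarrow> nat \<Rightarrow> nat \<Rightarrow> nat" where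
  "graph_dist E u v = (LEAST k. (u, v) \<in> E ^^ k)"

definition cube_distance_partition :: "nat \<Rightarrow> nat \<Rightarrow> nat set list" where
  "cube_distance_partition n a =
     map (\<lambda>j. {v. v < 2 ^ n \<and> graph_dist (cube_edges n) a v = j}) [0..<Suc n]"

definition is_ordered_partition :: "nat \<Rightarrow> nat set list \<Rightarrow> bool" where
  "is_ordered_partition N Vs \<longleftrightarrow> distinct Vs \<and> partition_on {..<N} (set Vs)"

text \<open>The indicator vector of a part \<open>V\<close> has Euclidean norm \<open>sqrt (card V)\<close>.\<close>

definition normalized_indicator_matrix :: "nat \<Rightarrow> nat set list \<Rightarrow> complex mat" where
  "normalized_indicator_matrix N Vs =
     mat N (length Vs)
       (\<lambda>(u, j). if u \<in> Vs ! j then 1 / complex_of_real (sqrt (real (card (Vs ! j)))) else 0)"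

definition cube_symmetrized_divisor_matrix :: "nat \<Rightarrow> nat \<Rightarrow> complex mat" where
  "cube_symmetrized_divisor_matrix n a =
     (let P = normalized_indicator_matrix (2 ^ n) (cube_distance_partition n a)
      in transpose_mat P * cube_matrix n * P)"

text \<open>
  The block of \<open>B\<close> with rows \<open>I\<close> and columns \<open>J\<close>. The indices are given as lists rather than
  sets so that blocks of different matrices can be compared along a prescribed
  correspondence of their indices.
\<close>

definition block :: "'a mat \<Rightarrow> nat list \<Rightarrow> nat list \<Rightarrow> 'a mat" where
  "block B I J = mat (length I) (length J) (\<lambda>(i, j). B $$ (I ! i, J ! j))"

text \<open>
  \<open>M + C (l I - F)\<^sup>-\<^sup>1 D\<close> over an arbitrary field. The matrix of rational functions is the instance
  where \<open>l\<close> is the indeterminate; then \<open>l I - F\<close> is invertible, so that \<open>the\<close> is harmless.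
\<close>

definition reduction :: "'a::field \<Rightarrow> nat list \<Rightarrow> 'a mat \<Rightarrow> 'a mat" where
  "reduction l S B =
     (let T = filter (\<lambda>i. i \<notin> set S) [0..<dim_row B];
          M = block B S S; C = block B S T; D = block B T S; F = block B T T
      in M + C * the (mat_inverse (l \<cdot>\<^sub>m 1\<^sub>m (length T) - F)) * D)"

definition rational_reduction :: "nat list \<Rightarrow> complex mat \<Rightarrow> complex poly fract mat" where
  "rational_reduction S B =
     reduction (to_fract [:0, 1:]) S (map_mat (\<lambda>c. to_fract [:c:]) B)"

definition matrix_exp :: "complex mat \<Rightarrow> complex mat" where
  "matrix_exp B =
     mat (dim_row B) (dim_row B) (\<lambda>(u, v). \<Sum>k. (B ^\<^sub>m k) $$ (u, v) / fact k)"

definition transition_matrix :: "complex mat \<Rightarrow> real \<Rightarrow> complex mat" where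
  "transition_matrix B t = matrix_exp ((- \<i> * complex_of_real t) \<cdot>\<^sub>m B)"

definition perfect_state_transfer :: "complex mat \<Rightarrow> nat \<Rightarrow> nat \<Rightarrow> real \<Rightarrow> bool" where
  "perfect_state_transfer B a b t \<longleftrightarrow>
     (\<exists>\<gamma>. cmod \<gamma> = 1 \<and>
        transition_matrix B t *\<^sub>v unit_vec (dim_row B) a = \<gamma> \<cdot>\<^sub>v unit_vec (dim_row B) b) \<and>
     (\<exists>\<gamma>. cmod \<gamma> = 1 \<and>
        transition_matrix B t *\<^sub>v unit_vec (dim_row B) b = \<gamma> \<cdot>\<^sub>v unit_vec (dim_row B) a)"

end

theory Submission
  imports Defs "Jordan_Normal_Form.Char_Poly"
begin

text \<open>
  The distance partition of the cube is equitable, so \<open>A P = P d\<close> just as \<open>A' P' = P' d\<close>. A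
  singleton part makes the corresponding row and column of the indicator matrix a unit vector.
  Hence every object built from \<open>A\<close> that is compatible with such an intertwining (powers, and
  thereby exponentials, and Schur complements) has the same \<open>{a, b}\<close> block as the object built
  from \<open>d\<close>, and likewise for \<open>A'\<close>.
  Column \<open>a\<close> of the exponential of \<open>A'\<close> is, up to positive factors that are constant on the
  parts, column \<open>a\<close> of the exponential of \<open>A\<close>. The latter is computed with the characters of
  \<open>(Z/2)\<^sup>n\<close>: at time \<open>pi/2\<close> the eigenvalue \<open>n - 2 |s|\<close> contributes \<open>(-i)\<^sup>n (-1)\<^bsup>|s|\<^esup>\<close>, and
  multiplying by \<open>(-1)\<^bsup>|s|\<^esup>\<close> turns the character expansion of a vertex into that of its antipode.
\<close>

section \<open>Schur complements and intertwining matrices\<close>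

lemma index_mult_mat_sum:
  assumes "i < dim_row A" "j < dim_col B" "dim_col A = dim_row B"
  shows "(A * B) $$ (i, j) = (\<Sum>k<dim_row B. A $$ (i, k) * B $$ (k, j))"
  using assms by (simp add: scalar_prod_def atLeast0LessThan)

text \<open>Splits a matrix product along \<open>S\<close> and its complement. The complement is
  enumerated exactly as in \<open>reduction\<close>, so that the two sums become block
  products.\<close>

lemma sum_lessThan_split_list:
  fixes f :: "nat \<Rightarrow> 'a :: comm_monoid_add"
  assumes "distinct S" "set S \<subseteq> {..<N}"
  defines "T \<equiv> filter (\<lambda>i. i \<notin> set S) [0..<N]"
  shows "(\<Sum>j<N. f j) = (\<Sum>q<length S. f (S ! q)) + (\<Sum>q<length T. f (T ! q))"
proof -
  have nth: "(\<Sum>q<length xs. f (xs ! q)) = sum f (set xs)" if "distinct xs" for xs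
    by (rule sum.reindex_bij_betw[OF bij_betw_nth]) (use that in auto)
  have "{..<N} = set S \<union> set T"
    using assms by auto
  hence "(\<Sum>j<N. f j) = sum f (set S) + sum f (set T)"
    by (simp only:) (rule sum.union_disjoint, auto simp: T_def)
  thus ?thesis
    using assms by (simp add: nth T_def)
qed

text \<open>
  The Schur complement \<open>R = M + C (l I - F)\<^sup>-\<^sup>1 D\<close> is read off from the matrix \<open>Y\<close> obtained by
  stacking \<open>I\<close> and \<open>(l I - F)\<^sup>-\<^sup>1 D\<close>: the product \<open>B * Y\<close> stacks \<open>R\<close> and the lower block of \<open>l Y\<close>.
\<close>

definition schur_extension :: "'a::field \<Rightarrow> nat list \<Rightarrow> 'a mat \<Rightarrow> 'a mat \<Rightarrow> 'a mat \<Rightarrow> bool" where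
  "schur_extension l S B Y R \<longleftrightarrow>
     Y \<in> carrier_mat (dim_row B) (length S) \<and> R \<in> carrier_mat (length S) (length S) \<and>
     (\<forall>i<length S. \<forall>k<length S. Y $$ (S ! i, k) = (if i = k then 1 else 0)) \<and>
     (\<forall>i<length S. \<forall>k<length S. (B * Y) $$ (S ! i, k) = R $$ (i, k)) \<and>
     (\<forall>u<dim_row B. \<forall>k<length S. u \<notin> set S \<longrightarrow> (B * Y) $$ (u, k) = l * Y $$ (u, k))"

text \<open>The matrix \<open>l I - F\<close> inverted in \<open>reduction\<close>, named so that
  its invertibility can be stated as a hypothesis.\<close>

definition outer_resolvent :: "'a::field \<Rightarrow> nat list \<Rightarrow> 'a mat \<Rightarrow> 'a mat" where
  "outer_resolvent l S B =
     (let T = filter (\<lambda>i. i \<notin> set S) [0..<dim_row B] in l \<cdot>\<^sub>m 1\<^sub>m (length T) - block B T T)"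

lemma block_carrier [simp]: "block B I J \<in> carrier_mat (length I) (length J)"
  by (simp add: block_def)

lemma mat_inverse_the:
  fixes A :: "'a::field mat"
  assumes "A \<in> carrier_mat n n" "det A \<noteq> 0"
  shows "A * the (mat_inverse A) = 1\<^sub>m n" "the (mat_inverse A) * A = 1\<^sub>m n"
    "the (mat_inverse A) \<in> carrier_mat n n"
proof -
  have "mat_inverse A \<noteq> None"
    using mat_inverse(1)[OF assms(1), of "()"] det_non_zero_imp_unit[OF assms, of "()"] by blast
  then obtain X where "mat_inverse A = Some X" by auto
  with mat_inverse(2)[OF assms(1) this]
  show "A * the (mat_inverse A) = 1\<^sub>m n" "the (mat_inverse A) * A = 1\<^sub>m n"
    "the (mat_inverse A) \<in> carrier_mat n n" by auto
qed

text \<open>Characterises the Schur complement by linear equations free of inverses, which can be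
  carried along an intertwining matrix. For existence, the lower block of \<open>Y\<close> is
  \<open>(l I - F)^-1 D\<close>; for uniqueness, the equations outside \<open>S\<close> force the
  lower block to be this.\<close>

lemma schur_extension_reduction:
  fixes B :: "'a::field mat"
  assumes B: "B \<in> carrier_mat N N" and S: "distinct S" "set S \<subseteq> {..<N}"
    and inv: "det (outer_resolvent l S B) \<noteq> 0"
  shows "\<exists>Y. schur_extension l S B Y (reduction l S B)"
    and "schur_extension l S B Y R \<Longrightarrow> reduction l S B = R"
proof -
  define T where "T = filter (\<lambda>i. i \<notin> set S) [0..<N]"
  let ?s = "length S" and ?t = "length T"
  have T: "distinct T" "set T = {..<N} - set S"
    by (auto simp: T_def)
  have SN: "S ! i < N" if "i < ?s" for i
    using nth_mem[OF that] S by auto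
  have TN: "T ! i < N" "T ! i \<notin> set S" if "i < ?t" for i
    using nth_mem[OF that] T by auto
  define L where "L = outer_resolvent l S B"
  have dimB: "dim_row B = N" "dim_col B = N" using B by auto
  have L_eq: "L = l \<cdot>\<^sub>m 1\<^sub>m ?t - block B T T"
    unfolding L_def outer_resolvent_def Let_def dimB T_def ..
  have L: "L \<in> carrier_mat ?t ?t"
    unfolding L_eq by (intro minus_carrier_mat) simp
  define G where "G = the (mat_inverse L)"
  have G: "L * G = 1\<^sub>m ?t" "G * L = 1\<^sub>m ?t" "G \<in> carrier_mat ?t ?t"
    using mat_inverse_the[OF L] inv by (auto simp: G_def L_def)
  have red: "reduction l S B = block B S S + block B S T * G * block B T S"
    unfolding reduction_def Let_def G_def L_eq dimB T_def ..
  have split: "(B * Y) $$ (u, k) =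
      (\<Sum>q<?s. B $$ (u, S ! q) * Y $$ (S ! q, k)) + (\<Sum>q<?t. B $$ (u, T ! q) * Y $$ (T ! q, k))"
    if "u < N" "k < ?s" "Y \<in> carrier_mat N ?s" for u k Y
    using that B sum_lessThan_split_list[OF S, of "\<lambda>j. B $$ (u, j) * Y $$ (j, k)"]
    by (subst index_mult_mat_sum) (auto simp: T_def)
  \<comment> \<open>The rows \<open>S\<close> of \<open>Y\<close> form the identity, so the first
    sum leaves only column \<open>S ! k\<close> of \<open>B\<close>.\<close>
  have split': "(B * Y) $$ (u, k) =
      B $$ (u, S ! k) + (\<Sum>q<?t. B $$ (u, T ! q) * X $$ (q, k))"
    if "u < N" "k < ?s" "Y \<in> carrier_mat N ?s"
      "\<And>i k. i < ?s \<Longrightarrow> k < ?s \<Longrightarrow> Y $$ (S ! i, k) = (if i = k then 1 else 0)"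
      "\<And>i k. i < ?t \<Longrightarrow> k < ?s \<Longrightarrow> Y $$ (T ! i, k) = X $$ (i, k)" for u k Y X
  proof -
    have "(\<Sum>q<?s. B $$ (u, S ! q) * Y $$ (S ! q, k)) =
          (\<Sum>q<?s. if q = k then B $$ (u, S ! q) else 0)"
      by (rule sum.cong) (use that in auto)
    also have "\<dots> = B $$ (u, S ! k)" using that by simp
    finally show ?thesis using that by (simp add: split)
  qed
  \<comment> \<open>Together with \<open>split'\<close> this gives
    \<open>B Y = l Y + D - L X\<close> on the rows \<open>T\<close>, so that
    \<open>B Y = l Y\<close> there amounts to \<open>L X = D\<close>.\<close>
  have LX: "(L * X) $$ (r, k) = l * X $$ (r, k) - (\<Sum>q<?t. B $$ (T ! r, T ! q) * X $$ (q, k))"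
    if "r < ?t" "k < ?s" "X \<in> carrier_mat ?t ?s" for r k X
  proof -
    have "(L * X) $$ (r, k) = (\<Sum>q<?t. L $$ (r, q) * X $$ (q, k))"
      using L that by (subst index_mult_mat_sum) auto
    also have "\<dots> = (\<Sum>q<?t. (if q = r then l * X $$ (q, k) else 0)
                              - B $$ (T ! r, T ! q) * X $$ (q, k))"
      by (rule sum.cong) (use that in \<open>auto simp: L_eq block_def algebra_simps\<close>)
    also have "\<dots> = l * X $$ (r, k) - (\<Sum>q<?t. B $$ (T ! r, T ! q) * X $$ (q, k))"
      using that by (simp add: sum_subtractf)
    finally show ?thesis .
  qed
  have red_entry: "reduction l S B $$ (i, k) =
      B $$ (S ! i, S ! k) + (\<Sum>q<?t. B $$ (S ! i, T ! q) * (G * block B T S) $$ (q, k))"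
    if "i < ?s" "k < ?s" for i k
  proof -
    have "block B S T * G * block B T S = block B S T * (G * block B T S)"
      by (rule assoc_mult_mat[OF block_carrier G(3) block_carrier])
    moreover have "(block B S T * (G * block B T S)) $$ (i, k) =
        (\<Sum>q<?t. B $$ (S ! i, T ! q) * (G * block B T S) $$ (q, k))"
      using that G by (subst index_mult_mat_sum) (auto simp: block_def)
    ultimately show ?thesis using that G by (simp add: red block_def)
  qed
  have redC: "reduction l S B \<in> carrier_mat ?s ?s"
    unfolding red using G by (intro add_carrier_mat mult_carrier_mat) auto

  show "\<exists>Y. schur_extension l S B Y (reduction l S B)"
  proof -
    define X where "X = G * block B T S"
    have X: "X \<in> carrier_mat ?t ?s" using G unfolding X_def by (intro mult_carrier_mat) auto
    have "L * X = block B T S"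
      unfolding X_def using assoc_mult_mat[OF L G(3) block_carrier[of B T S]]
      by (simp add: G(1) left_mult_one_mat[OF block_carrier])
    hence LXD: "(L * X) $$ (r, k) = B $$ (T ! r, S ! k)" if "r < ?t" "k < ?s" for r k
      using that by (simp add: block_def)
    \<comment> \<open>The position of a vertex in the list \<open>T\<close>, needed to place the
      rows of \<open>X\<close> into \<open>Y\<close>.\<close>
    define idx where "idx = the_inv_into {..<?t} ((!) T)"
    have idx: "idx (T ! r) = r" if "r < ?t" for r
      unfolding idx_def using that T(1) by (intro the_inv_into_f_f inj_on_nth) auto
    define Y where "Y = mat N ?s (\<lambda>(u, k).
        if u \<in> set S then (if u = S ! k then 1 else 0) else X $$ (idx u, k))"
    have Y: "Y \<in> carrier_mat N ?s" by (simp add: Y_def)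
    have Y1: "Y $$ (S ! i, k) = (if i = k then 1 else 0)" if "i < ?s" "k < ?s" for i k
      using that SN S by (simp add: Y_def nth_eq_iff_index_eq)
    have Y2: "Y $$ (T ! i, k) = X $$ (i, k)" if "i < ?t" "k < ?s" for i k
      using that TN by (simp add: Y_def idx)
    have "(B * Y) $$ (u, k) = l * Y $$ (u, k)" if "u < N" "k < ?s" "u \<notin> set S" for u k
    proof -
      from that T have "u \<in> set T" by auto
      then obtain r where r: "r < ?t" "u = T ! r" by (auto simp: in_set_conv_nth)
      show ?thesis
        using split'[OF that(1,2) Y Y1 Y2] LX[OF r(1) that(2) X] LXD[OF r(1) that(2)] Y2 r that
        by (simp add: algebra_simps)
    qed
    moreover have "(B * Y) $$ (S ! i, k) = reduction l S B $$ (i, k)" if "i < ?s" "k < ?s" for i k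
      using split'[OF SN that(2) Y Y1 Y2] that red_entry by (simp add: X_def)
    ultimately have "schur_extension l S B Y (reduction l S B)"
      unfolding schur_extension_def dimB using Y Y1 redC by blast
    thus ?thesis ..
  qed

  show "reduction l S B = R" if ext: "schur_extension l S B Y R"
  proof -
    have Y: "Y \<in> carrier_mat N ?s" and R: "R \<in> carrier_mat ?s ?s"
      and Y1: "\<And>i k. i < ?s \<Longrightarrow> k < ?s \<Longrightarrow> Y $$ (S ! i, k) = (if i = k then 1 else 0)"
      and YR: "\<And>i k. i < ?s \<Longrightarrow> k < ?s \<Longrightarrow> (B * Y) $$ (S ! i, k) = R $$ (i, k)"
      and Yl: "\<And>u k. u < N \<Longrightarrow> k < ?s \<Longrightarrow> u \<notin> set S \<Longrightarrow> (B * Y) $$ (u, k) = l * Y $$ (u, k)"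
      using ext unfolding schur_extension_def dimB by blast+
    define X where "X = mat ?t ?s (\<lambda>(q, k). Y $$ (T ! q, k))"
    have X: "X \<in> carrier_mat ?t ?s" by (simp add: X_def)
    have Y2: "Y $$ (T ! i, k) = X $$ (i, k)" if "i < ?t" "k < ?s" for i k
      using that by (simp add: X_def)
    have "L * X = block B T S"
    proof (rule eq_matI)
      fix r k assume "r < dim_row (block B T S)" "k < dim_col (block B T S)"
      hence rk: "r < ?t" "k < ?s" by (simp_all add: block_def)
      show "(L * X) $$ (r, k) = block B T S $$ (r, k)"
        using split'[OF TN(1)[OF rk(1)] rk(2) Y Y1 Y2] Yl[OF TN(1)[OF rk(1)] rk(2) TN(2)[OF rk(1)]]
          LX[OF rk X] Y2[OF rk] rk
        by (simp add: block_def algebra_simps)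
    qed (use L X in \<open>auto simp: block_def\<close>)
    \<comment> \<open>Multiplying \<open>L X = D\<close> by the left inverse \<open>G\<close>
      identifies \<open>X\<close> with the block used in \<open>red_entry\<close>.\<close>
    hence "G * block B T S = (G * L) * X"
      using G L X by (subst assoc_mult_mat) auto
    hence GX: "G * block B T S = X" using G X by simp
    show ?thesis
    proof (rule eq_matI)
      fix i k assume "i < dim_row R" "k < dim_col R"
      hence ik: "i < ?s" "k < ?s" using R by auto
      show "reduction l S B $$ (i, k) = R $$ (i, k)"
        using split'[OF SN[OF ik(1)] ik(2) Y Y1 Y2] YR[OF ik] red_entry[OF ik] by (simp add: GX)
    qed (use R redC in auto)
  qed
qed

text \<open>If \<open>Y\<close> extends the identity for \<open>d\<close>, then \<open>P Y\<close>
  does so for \<open>B\<close>, with the same \<open>R\<close>, because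
  \<open>B P Y = P d Y\<close>. The unit rows of \<open>P\<close> copy the rows \<open>S'\<close> to
  the rows \<open>S\<close>, and the unit columns keep the rows \<open>S'\<close> from reaching any
  other row.\<close>

lemma reduction_intertwine:
  fixes B d P :: "'a::field mat"
  assumes B: "B \<in> carrier_mat N N" and d: "d \<in> carrier_mat p p" and P: "P \<in> carrier_mat N p"
    and BP: "B * P = P * d"
    and S: "distinct S" "set S \<subseteq> {..<N}" and S': "distinct S'" "set S' \<subseteq> {..<p}"
    and len: "length S' = length S"
    and row: "\<And>i j. i < length S \<Longrightarrow> j < p \<Longrightarrow> P $$ (S ! i, j) = (if j = S' ! i then 1 else 0)"
    and col: "\<And>i u. i < length S \<Longrightarrow> u < N \<Longrightarrow> P $$ (u, S' ! i) = (if u = S ! i then 1 else 0)"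
    and inv: "det (outer_resolvent l S B) \<noteq> 0" "det (outer_resolvent l S' d) \<noteq> 0"
  shows "reduction l S B = reduction l S' d"
proof -
  define R where "R = reduction l S' d"
  obtain Y where "schur_extension l S' d Y R"
    using schur_extension_reduction(1)[OF d S' inv(2)] R_def by blast
  hence Y: "Y \<in> carrier_mat p (length S)" and R: "R \<in> carrier_mat (length S) (length S)"
    and Y1: "\<And>i k. i < length S \<Longrightarrow> k < length S \<Longrightarrow> Y $$ (S' ! i, k) = (if i = k then 1 else 0)"
    and YR: "\<And>i k. i < length S \<Longrightarrow> k < length S \<Longrightarrow> (d * Y) $$ (S' ! i, k) = R $$ (i, k)"
    and Yl: "\<And>u k. u < p \<Longrightarrow> k < length S \<Longrightarrow> u \<notin> set S' \<Longrightarrow> (d * Y) $$ (u, k) = l * Y $$ (u, k)"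
    using d unfolding schur_extension_def len by auto
  have SN: "S ! i < N" "S' ! i < p" if "i < length S" for i
    using that S(2) S'(2) len nth_mem[of i S] nth_mem[of i S'] by (auto simp: subset_iff)
  have PZ: "(P * Z) $$ (S ! i, k) = Z $$ (S' ! i, k)"
    if "i < length S" "k < length S" "Z \<in> carrier_mat p (length S)" for i k Z
  proof -
    have "(P * Z) $$ (S ! i, k) = (\<Sum>j<p. P $$ (S ! i, j) * Z $$ (j, k))"
      using that P SN by (subst index_mult_mat_sum) auto
    also have "\<dots> = (\<Sum>j<p. if j = S' ! i then Z $$ (j, k) else 0)"
      by (rule sum.cong) (use that row in auto)
    finally show ?thesis using that SN by simp
  qed
  have dY: "d * Y \<in> carrier_mat p (length S)" using d Y by simp
  have BPY: "B * (P * Y) = P * (d * Y)"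
  proof -
    have "B * (P * Y) = B * P * Y" by (rule assoc_mult_mat[symmetric, OF B P Y])
    also have "\<dots> = P * (d * Y)" unfolding BP by (rule assoc_mult_mat[OF P d Y])
    finally show ?thesis .
  qed
  have "(P * (d * Y)) $$ (u, k) = l * (P * Y) $$ (u, k)"
    if "u < N" "k < length S" "u \<notin> set S" for u k
  proof -
    have "(P * (d * Y)) $$ (u, k) = (\<Sum>j<p. P $$ (u, j) * (d * Y) $$ (j, k))"
      using that P dY by (subst index_mult_mat_sum) auto
    also have "\<dots> = (\<Sum>j<p. l * (P $$ (u, j) * Y $$ (j, k)))"
    proof (rule sum.cong)
      fix j assume "j \<in> {..<p}"
      hence j: "j < p" by simp
      show "P $$ (u, j) * (d * Y) $$ (j, k) = l * (P $$ (u, j) * Y $$ (j, k))"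
      \<comment> \<open>The rows of \<open>d Y\<close> that need not equal \<open>l Y\<close> are
        those in \<open>S'\<close>. They enter with coefficient 0, since column
        \<open>S' ! i\<close> of \<open>P\<close> is supported at \<open>S ! i\<close> and
        \<open>u\<close> lies outside \<open>S\<close>.\<close>
      proof (cases "j \<in> set S'")
        case True
        then obtain i where "i < length S" "j = S' ! i" using len by (auto simp: in_set_conv_nth)
        moreover from this have "u \<noteq> S ! i" using that by auto
        ultimately have "P $$ (u, j) = 0" using col that by simp
        thus ?thesis by simp
      next
        case False
        thus ?thesis using Yl[OF j that(2)] by simp
      qed
    qed simp
    also have "\<dots> = l * (P * Y) $$ (u, k)"
      using that P Y by (subst index_mult_mat_sum) (auto simp: sum_distrib_left)
    finally show ?thesis .
  qed
  hence "schur_extension l S B (P * Y) R"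
    unfolding schur_extension_def BPY using B P Y R dY by (auto simp: PZ Y1 YR)
  thus ?thesis
    using schur_extension_reduction(2)[OF B S inv(1)] R_def by blast
qed

section \<open>Reductions over the field of rational functions\<close>

interpretation to_fract_hom: comm_ring_hom to_fract
  by unfold_locales auto

text \<open>The determinant is the characteristic polynomial of the complementary block, which is
  monic, and the embedding of polynomials into fractions is injective.\<close>

lemma outer_resolvent_det_nonzero:
  fixes B :: "complex mat"
  assumes B: "B \<in> carrier_mat N N" and S: "set S \<subseteq> {..<N}"
  shows "det (outer_resolvent (to_fract [:0, 1:]) S (map_mat (\<lambda>c. to_fract [:c:]) B)) \<noteq> 0"
proof -
  define T where "T = filter (\<lambda>i. i \<notin> set S) [0..<N]"
  have TN: "T ! i < N" if "i < length T" for i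
    using nth_mem[OF that] by (auto simp: T_def)
  have "outer_resolvent (to_fract [:0, 1:]) S (map_mat (\<lambda>c. to_fract [:c:]) B) =
        map_mat to_fract (char_poly_matrix (block B T T))"
    using B TN unfolding outer_resolvent_def Let_def
    by (intro eq_matI) (auto simp: char_poly_matrix_def block_def T_def[symmetric] simp flip: to_fract_diff to_fract_mult to_fract_uminus)
  hence "det (outer_resolvent (to_fract [:0, 1:]) S (map_mat (\<lambda>c. to_fract [:c:]) B)) =
        to_fract (char_poly (block B T T))"
    by (simp only: to_fract_hom.hom_det char_poly_def)
  moreover have "char_poly (block B T T) \<noteq> 0"
    using degree_monic_char_poly[OF block_carrier[of B T T]] by (metis coeff_0 zero_neq_one)
  ultimately show ?thesis by simp
qed

text \<open>Embedding the scalars as constant rational functions is a ring homomorphism, so it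
  preserves \<open>B * P = P * d\<close> as well as the unit rows and columns of
  \<open>P\<close>.\<close>

lemma rational_reduction_intertwine:
  fixes B d P :: "complex mat"
  assumes B: "B \<in> carrier_mat N N" and d: "d \<in> carrier_mat p p" and P: "P \<in> carrier_mat N p"
    and BP: "B * P = P * d"
    and S: "distinct S" "set S \<subseteq> {..<N}" and S': "distinct S'" "set S' \<subseteq> {..<p}"
    and len: "length S' = length S"
    and row: "\<And>i j. i < length S \<Longrightarrow> j < p \<Longrightarrow> P $$ (S ! i, j) = (if j = S' ! i then 1 else 0)"
    and col: "\<And>i u. i < length S \<Longrightarrow> u < N \<Longrightarrow> P $$ (u, S' ! i) = (if u = S ! i then 1 else 0)"
  shows "rational_reduction S B = rational_reduction S' d"
proof -
  let ?h = "\<lambda>c::complex. to_fract [:c:]"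
  interpret h: comm_ring_hom ?h
    by unfold_locales (auto simp: one_pCons simp flip: to_fract_add to_fract_mult to_fract_1)
  have SN: "S ! i < N" "S' ! i < p" if "i < length S" for i
    using that S(2) S'(2) len nth_mem[of i S] nth_mem[of i S'] by (auto simp: subset_iff)
  have "map_mat ?h B * map_mat ?h P = map_mat ?h P * map_mat ?h d"
    using h.mat_hom_mult[OF B P] h.mat_hom_mult[OF P d] BP by simp
  thus ?thesis
    unfolding rational_reduction_def using B d P SN
    by (intro reduction_intertwine[OF _ _ _ _ S S' len]) 
       (auto simp: row col outer_resolvent_det_nonzero[OF _ S(2)] outer_resolvent_det_nonzero[OF _ S'(2)])
qed

section \<open>Quotients of matrices by ordered partitions\<close>

lemma ordered_partition_cell:
  assumes "is_ordered_partition N Vs" "u < N"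
  obtains i where "i < length Vs" "u \<in> Vs ! i"
proof -
  have "u \<in> \<Union>(set Vs)"
    using assms by (auto simp: is_ordered_partition_def partition_on_def)
  thus thesis using that by (auto simp: in_set_conv_nth)
qed

lemma ordered_partition_cell_unique:
  assumes "is_ordered_partition N Vs" "i < length Vs" "j < length Vs" "u \<in> Vs ! i" "u \<in> Vs ! j"
  shows "i = j"
proof -
  have "disjoint (set Vs)" "distinct Vs"
    using assms(1) by (auto simp: is_ordered_partition_def partition_on_def)
  moreover have "Vs ! i \<in> set Vs" "Vs ! j \<in> set Vs" "Vs ! i \<inter> Vs ! j \<noteq> {}"
    using assms by auto
  ultimately show ?thesis
    using assms(2,3) by (metis disjointD nth_eq_iff_index_eq)
qed

lemma ordered_partition_part:
  assumes "is_ordered_partition N Vs" "i < length Vs"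
  shows "Vs ! i \<subseteq> {..<N}" "finite (Vs ! i)" "card (Vs ! i) > 0"
proof -
  have "Vs ! i \<in> set Vs" using assms by simp
  thus sub: "Vs ! i \<subseteq> {..<N}"
    using assms(1) by (auto simp: is_ordered_partition_def partition_on_def)
  thus fin: "finite (Vs ! i)" by (rule finite_subset) simp
  have "Vs ! i \<noteq> {}"
    using assms(1) \<open>Vs ! i \<in> set Vs\<close> by (auto simp: is_ordered_partition_def partition_on_def)
  thus "card (Vs ! i) > 0" using fin by (simp add: card_gt_0_iff)
qed

lemma normalized_indicator_matrix_carrier [simp]:
  "normalized_indicator_matrix N Vs \<in> carrier_mat N (length Vs)"
  by (simp add: normalized_indicator_matrix_def)

lemma normalized_indicator_matrix_singleton_col:
  assumes "Vs ! j = {x}" "j < length Vs" "u < N"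
  shows "normalized_indicator_matrix N Vs $$ (u, j) = (if u = x then 1 else 0)"
  using assms by (simp add: normalized_indicator_matrix_def)

lemma normalized_indicator_matrix_row:
  assumes "is_ordered_partition N Vs" "i < length Vs" "j < length Vs" "u \<in> Vs ! i"
  shows "normalized_indicator_matrix N Vs $$ (u, j) =
           (if j = i then 1 / complex_of_real (sqrt (real (card (Vs ! i)))) else 0)"
proof -
  have "u < N" using ordered_partition_part(1)[OF assms(1,2)] assms(4) by auto
  thus ?thesis
    using ordered_partition_cell_unique[OF assms(1-3)] assms
    by (auto simp: normalized_indicator_matrix_def)
qed

text \<open>A row of the indicator matrix has a single nonzero entry, in the column of the part
  containing \<open>u\<close>.\<close>

lemma normalized_indicator_matrix_mult_row:
  fixes M :: "complex mat"
  assumes "is_ordered_partition N Vs" "i < length Vs" "u \<in> Vs ! i"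
    and "M \<in> carrier_mat (length Vs) q" "j < q"
  shows "(normalized_indicator_matrix N Vs * M) $$ (u, j) =
           M $$ (i, j) / complex_of_real (sqrt (real (card (Vs ! i))))"
proof -
  let ?P = "normalized_indicator_matrix N Vs"
  have "u < N" using ordered_partition_part(1)[OF assms(1,2)] assms(3) by auto
  hence "(?P * M) $$ (u, j) = (\<Sum>k<length Vs. ?P $$ (u, k) * M $$ (k, j))"
    using assms by (subst index_mult_mat_sum) (auto simp: normalized_indicator_matrix_def)
  also have "\<dots> = (\<Sum>k<length Vs. if k = i
                 then M $$ (i, j) / complex_of_real (sqrt (real (card (Vs ! i)))) else 0)"
    using assms by (intro sum.cong) (auto simp: normalized_indicator_matrix_row)
  finally show ?thesis using assms by simp
qed

text \<open>Distinct columns have disjoint supports, and a part of size \<open>c\<close> contributes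
  \<open>c\<close> terms \<open>1 / c\<close>. This recovers the quotient matrix from the product
  that defines the symmetrized divisor matrix.\<close>

lemma normalized_indicator_matrix_orthonormal:
  assumes "is_ordered_partition N Vs"
  shows "transpose_mat (normalized_indicator_matrix N Vs) * normalized_indicator_matrix N Vs
           = 1\<^sub>m (length Vs)" (is "transpose_mat ?P * ?P = _")
proof (rule eq_matI)
  fix i j assume "i < dim_row (1\<^sub>m (length Vs) :: complex mat)" "j < dim_col (1\<^sub>m (length Vs) :: complex mat)"
  hence ij: "i < length Vs" "j < length Vs" by auto
  let ?c = "complex_of_real (sqrt (real (card (Vs ! i))))"
  have "(transpose_mat ?P * ?P) $$ (i, j) = (\<Sum>u<N. ?P $$ (u, i) * ?P $$ (u, j))"
    using ij by (subst index_mult_mat_sum) (auto simp: normalized_indicator_matrix_def)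
  also have "\<dots> = (\<Sum>u<N. if u \<in> Vs ! i then (if i = j then 1 / (?c * ?c) else 0) else 0)"
    using ij by (intro sum.cong)
      (auto simp: normalized_indicator_matrix_def dest: ordered_partition_cell_unique[OF assms])
  also have "\<dots> = (\<Sum>u\<in>Vs ! i. if i = j then 1 / (?c * ?c) else 0)"
    using ordered_partition_part(1)[OF assms ij(1)]
    by (subst sum.inter_restrict[symmetric]) (auto simp: Int_absorb1)
  also have "\<dots> = (if i = j then of_nat (card (Vs ! i)) / (?c * ?c) else 0)"
    by simp
  also have "?c * ?c = of_nat (card (Vs ! i))"
    by (simp flip: of_real_mult)
  finally show "(transpose_mat ?P * ?P) $$ (i, j) = 1\<^sub>m (length Vs) $$ (i, j)"
    using ij ordered_partition_part(3)[OF assms ij(1)] by (cases "i = j") simp_all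
qed (auto simp: normalized_indicator_matrix_def)

section \<open>Powers and exponentials of intertwined matrices\<close>

lemma pow_mat_intertwine:
  fixes B d P :: "'a::comm_ring_1 mat"
  assumes "B \<in> carrier_mat N N" "d \<in> carrier_mat p p" "P \<in> carrier_mat N p" "B * P = P * d"
  shows "B ^\<^sub>m k * P = P * d ^\<^sub>m k"
proof (induction k)
  case 0
  show ?case using assms by simp
next
  case (Suc k)
  have "B ^\<^sub>m Suc k * P = B ^\<^sub>m k * (P * d)"
    using assms by (simp add: assoc_mult_mat[of _ N N _ N _ p])
  also have "\<dots> = (P * d ^\<^sub>m k) * d"
    using assms by (simp flip: Suc.IH add: assoc_mult_mat[of _ N N _ p _ p])
  also have "\<dots> = P * d ^\<^sub>m Suc k"
    using assms by (simp add: assoc_mult_mat[of _ N p _ p _ p])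
  finally show ?case .
qed

text \<open>Compare entry \<open>(u, j)\<close> of both sides of \<open>B^k P = P d^k\<close>. On
  the left the singleton part \<open>j\<close> selects column \<open>x\<close> of the power; on the
  right row \<open>u\<close> of \<open>P\<close> selects row \<open>i\<close> and contributes the
  factor.\<close>

lemma pow_mat_entry_quotient:
  fixes B d :: "complex mat"
  assumes Vs: "is_ordered_partition N Vs" and B: "B \<in> carrier_mat N N"
    and d: "d \<in> carrier_mat (length Vs) (length Vs)"
    and BP: "B * normalized_indicator_matrix N Vs = normalized_indicator_matrix N Vs * d"
    and i: "i < length Vs" "u \<in> Vs ! i" and j: "j < length Vs" "Vs ! j = {x}"
  shows "(B ^\<^sub>m k) $$ (u, x) = (d ^\<^sub>m k) $$ (i, j) / complex_of_real (sqrt (real (card (Vs ! i))))"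
proof -
  let ?P = "normalized_indicator_matrix N Vs"
  have ux: "u < N" "x < N"
    using ordered_partition_part(1)[OF Vs i(1)] ordered_partition_part(1)[OF Vs j(1)] i j by auto
  have Bk: "B ^\<^sub>m k \<in> carrier_mat N N" using B by simp
  have "(B ^\<^sub>m k * ?P) $$ (u, j) = (\<Sum>v<N. (B ^\<^sub>m k) $$ (u, v) * ?P $$ (v, j))"
    using ux Bk B j by (subst index_mult_mat_sum) (auto simp: normalized_indicator_matrix_def)
  also have "\<dots> = (\<Sum>v<N. if v = x then (B ^\<^sub>m k) $$ (u, v) else 0)"
    using j by (intro sum.cong) (auto simp: normalized_indicator_matrix_singleton_col)
  also have "\<dots> = (B ^\<^sub>m k) $$ (u, x)" using ux by simp
  finally show ?thesis
    using pow_mat_intertwine[OF B d _ BP] d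
      normalized_indicator_matrix_mult_row[OF Vs i pow_carrier_mat[OF d] j(1)] by simp
qed

lemma smult_intertwine:
  fixes B d P :: "'a::comm_ring_1 mat"
  assumes "B \<in> carrier_mat N N" "d \<in> carrier_mat p p" "P \<in> carrier_mat N p" "B * P = P * d"
  shows "(c \<cdot>\<^sub>m B) * P = P * (c \<cdot>\<^sub>m d)"
  using assms by (simp add: mult_smult_distrib[of _ N p _ p] mult_smult_assoc_mat[of _ N N _ p])

lemma transition_matrix_entry:
  assumes "B \<in> carrier_mat N N" "u < N" "v < N"
  shows "transition_matrix B t $$ (u, v) =
           (\<Sum>k. (((- \<i> * complex_of_real t) \<cdot>\<^sub>m B) ^\<^sub>m k) $$ (u, v) / fact k)"
  using assms by (simp add: transition_matrix_def matrix_exp_def)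

lemma transition_matrix_carrier [simp]:
  assumes "B \<in> carrier_mat N N"
  shows "transition_matrix B t \<in> carrier_mat N N"
  using assms by (auto simp: transition_matrix_def matrix_exp_def)

text \<open>
  Equal cell sizes make the scaling factor \<open>1\<close>, and then the two series agree termwise, so that
  convergence is needed only for different sizes.
\<close>

lemma transition_matrix_quotient_transfer:
  fixes B B' d :: "complex mat"
  assumes Vs: "is_ordered_partition N Vs" and B: "B \<in> carrier_mat N N"
    and BP: "B * normalized_indicator_matrix N Vs = normalized_indicator_matrix N Vs * d"
    and Vs': "is_ordered_partition N' Vs'" and B': "B' \<in> carrier_mat N' N'"
    and BP': "B' * normalized_indicator_matrix N' Vs' = normalized_indicator_matrix N' Vs' * d"
    and d: "d \<in> carrier_mat p p" and len: "length Vs = p" "length Vs' = p"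
    and i: "i < p" "u \<in> Vs ! i" "u' \<in> Vs' ! i"
    and j: "j < p" "Vs ! j = {x}" "Vs' ! j = {x'}"
    and summable: "card (Vs ! i) = card (Vs' ! i) \<or>
      summable (\<lambda>k. (((- \<i> * complex_of_real t) \<cdot>\<^sub>m B) ^\<^sub>m k) $$ (u, x) / fact k)"
  shows "transition_matrix B' t $$ (u', x') =
      transition_matrix B t $$ (u, x) *
        complex_of_real (sqrt (real (card (Vs ! i))) / sqrt (real (card (Vs' ! i))))"
proof -
  let ?c = "- \<i> * complex_of_real t"
  let ?r = "complex_of_real (sqrt (real (card (Vs ! i))) / sqrt (real (card (Vs' ! i))))"
  have dims: "u < N" "x < N" "u' < N'" "x' < N'"
    using ordered_partition_part(1)[OF Vs, of i] ordered_partition_part(1)[OF Vs, of j]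
      ordered_partition_part(1)[OF Vs', of i] ordered_partition_part(1)[OF Vs', of j] i j len by auto
  have pos: "card (Vs ! i) > 0" "card (Vs' ! i) > 0"
    using ordered_partition_part(3)[OF Vs] ordered_partition_part(3)[OF Vs'] i len by auto
  have P: "normalized_indicator_matrix N Vs \<in> carrier_mat N p"
    "normalized_indicator_matrix N' Vs' \<in> carrier_mat N' p"
    using normalized_indicator_matrix_carrier[of N Vs] normalized_indicator_matrix_carrier[of N' Vs'] len
    by auto
  \<comment> \<open>Both sides come from the same entry of a power of \<open>d\<close>, divided by
    the root of the respective part size, so their ratio does not depend on
    \<open>k\<close>.\<close>
  have entry: "((?c \<cdot>\<^sub>m B') ^\<^sub>m k) $$ (u', x') / fact k =
        ((?c \<cdot>\<^sub>m B) ^\<^sub>m k) $$ (u, x) / fact k * ?r" for k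
  proof -
    have "((?c \<cdot>\<^sub>m B) ^\<^sub>m k) $$ (u, x) =
        ((?c \<cdot>\<^sub>m d) ^\<^sub>m k) $$ (i, j) / complex_of_real (sqrt (real (card (Vs ! i))))"
      using B d len i j smult_intertwine[OF B d P(1) BP, of ?c]
      by (intro pow_mat_entry_quotient[OF Vs]) auto
    moreover have "((?c \<cdot>\<^sub>m B') ^\<^sub>m k) $$ (u', x') =
        ((?c \<cdot>\<^sub>m d) ^\<^sub>m k) $$ (i, j) / complex_of_real (sqrt (real (card (Vs' ! i))))"
      using B' d len i j smult_intertwine[OF B' d P(2) BP', of ?c]
      by (intro pow_mat_entry_quotient[OF Vs']) auto
    ultimately show ?thesis using pos by (simp add: field_simps)
  qed
  have "(\<Sum>k. ((?c \<cdot>\<^sub>m B) ^\<^sub>m k) $$ (u, x) / fact k * ?r) =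
        (\<Sum>k. ((?c \<cdot>\<^sub>m B) ^\<^sub>m k) $$ (u, x) / fact k) * ?r"
    using summable
  proof
    assume "card (Vs ! i) = card (Vs' ! i)"
    thus ?thesis using pos by simp
  qed (rule suminf_mult2[symmetric])
  thus ?thesis
    unfolding transition_matrix_entry[OF B dims(1,2)] transition_matrix_entry[OF B' dims(3,4)] entry .
qed

section \<open>Walks on the hypercube\<close>

text \<open>Being below \<open>2 ^ n\<close> means being fixed by truncation to the lowest
  \<open>n\<close> bits. This turns range conditions on vertices into conditions on
  coordinates.\<close>

lemma nat_less_power2_iff_bit: "(u::nat) < 2 ^ n \<longleftrightarrow> (\<forall>i. bit u i \<longrightarrow> i < n)"
proof -
  have "u < 2 ^ n \<longleftrightarrow> take_bit n u = u"
    by (simp add: take_bit_nat_eq_self_iff)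
  also have "\<dots> \<longleftrightarrow> (\<forall>i. bit u i \<longrightarrow> i < n)"
    by (auto simp: bit_eq_iff bit_take_bit_iff)
  finally show ?thesis .
qed

lemma nat_eq_iff_bit_lessThan:
  assumes "(u::nat) < 2 ^ n" "v < 2 ^ n"
  shows "u = v \<longleftrightarrow> (\<forall>i<n. bit u i = bit v i)"
  using assms by (auto simp: bit_eq_iff nat_less_power2_iff_bit)

lemma bit_flip_bit_nat: "bit (flip_bit i (u::nat)) j \<longleftrightarrow> (if i = j then \<not> bit u j else bit u j)"
  by (auto simp: bit_flip_bit_iff)

lemma flip_bit_less_power2: "u < 2 ^ n \<Longrightarrow> i < n \<Longrightarrow> flip_bit i (u::nat) < 2 ^ n"
  by (auto simp: nat_less_power2_iff_bit bit_flip_bit_nat split: if_splits)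

lemma inj_flip_bit: "inj_on (\<lambda>i. flip_bit i (u::nat)) A"
proof (rule inj_onI)
  fix i j assume "flip_bit i u = flip_bit j u"
  hence "bit (flip_bit i u) i = bit (flip_bit j u) i" by simp
  thus "i = j" by (auto simp: bit_flip_bit_nat split: if_splits)
qed

lemma cube_edges_sym: "(u, v) \<in> cube_edges n \<longleftrightarrow> (v, u) \<in> cube_edges n"
  unfolding cube_edges_def by (auto simp: eq_commute)

lemma cube_neighbours:
  assumes "v < 2 ^ n"
  shows "{w. (v, w) \<in> cube_edges n} = (\<lambda>i. flip_bit i v) ` {..<n}"
proof (intro equalityI subsetI)
  fix w assume "w \<in> {w. (v, w) \<in> cube_edges n}"
  hence w: "w < 2 ^ n" and "\<exists>!i. i < n \<and> bit v i \<noteq> bit w i"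
    unfolding cube_edges_def by blast+
  then obtain i where i: "i < n" "bit v i \<noteq> bit w i"
    and uniq: "\<And>j. j < n \<Longrightarrow> bit v j \<noteq> bit w j \<Longrightarrow> j = i"
    by blast
  have "\<forall>j<n. bit w j = bit (flip_bit i v) j"
    using i(2) uniq by (metis bit_flip_bit_nat)
  hence "w = flip_bit i v"
    using nat_eq_iff_bit_lessThan[OF w flip_bit_less_power2[OF assms i(1)]] by blast
  thus "w \<in> (\<lambda>i. flip_bit i v) ` {..<n}" using i by auto
next
  fix w assume "w \<in> (\<lambda>i. flip_bit i v) ` {..<n}"
  then obtain i where i: "i < n" "w = flip_bit i v" by auto
  have "\<exists>!j. j < n \<and> bit v j \<noteq> bit w j"
    using i by (intro ex1I[of _ i]) (auto simp: bit_flip_bit_nat split: if_splits)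
  thus "w \<in> {w. (v, w) \<in> cube_edges n}"
    using assms i flip_bit_less_power2[OF assms] by (simp add: cube_edges_def)
qed

lemma cube_matrix_carrier [simp]: "cube_matrix n \<in> carrier_mat (2 ^ n) (2 ^ n)"
  by (simp add: adjacency_matrix_def)

text \<open>The neighbours of \<open>v\<close> are its \<open>n\<close> bit flips, and different
  positions give different neighbours.\<close>

lemma cube_matrix_sum_row:
  assumes "v < 2 ^ n"
  shows "(\<Sum>w<2 ^ n. cube_matrix n $$ (v, w) * f w) = (\<Sum>i<n. f (flip_bit i v))"
proof -
  have nb: "{w. (v, w) \<in> cube_edges n} \<subseteq> {..<2 ^ n}" by (auto simp: cube_edges_def)
  have "(\<Sum>w<2 ^ n. cube_matrix n $$ (v, w) * f w) =
        (\<Sum>w<2 ^ n. if w \<in> {w. (v, w) \<in> cube_edges n} then f w else 0)"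
    using assms by (intro sum.cong) (auto simp: adjacency_matrix_def)
  also have "\<dots> = sum f {w. (v, w) \<in> cube_edges n}"
    using nb by (subst sum.inter_restrict[symmetric]) (auto simp: Int_absorb1)
  also have "\<dots> = (\<Sum>i<n. f (flip_bit i v))"
    unfolding cube_neighbours[OF assms] by (simp add: sum.reindex inj_flip_bit)
  finally show ?thesis .
qed

lemma cube_matrix_sum_col:
  assumes "v < 2 ^ n"
  shows "(\<Sum>w<2 ^ n. f w * cube_matrix n $$ (w, v)) = (\<Sum>i<n. f (flip_bit i v))"
proof -
  have "(\<Sum>w<2 ^ n. f w * cube_matrix n $$ (w, v)) = (\<Sum>w<2 ^ n. cube_matrix n $$ (v, w) * f w)"
    using assms cube_edges_sym by (intro sum.cong) (auto simp: adjacency_matrix_def)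
  thus ?thesis using cube_matrix_sum_row[OF assms] by simp
qed

section \<open>Characters of the cube and its exponential\<close>

text \<open>As a function of \<open>v\<close>, an eigenvector of the cube, scaled to be \<open>1\<close> at \<open>u\<close>.\<close>

definition cube_character :: "nat \<Rightarrow> nat set \<Rightarrow> nat \<Rightarrow> complex" where
  "cube_character u s v = (\<Prod>i\<in>s. if bit u i = bit v i then 1 else -1)"

text \<open>Only the factor at coordinate \<open>i\<close> changes, and only its sign.\<close>

lemma cube_character_flip_bit:
  assumes "finite s"
  shows "cube_character (flip_bit i u) s v = (if i \<in> s then -1 else 1) * cube_character u s v"
proof (cases "i \<in> s")
  case True
  have rest: "(\<Prod>j\<in>s - {i}. if bit (flip_bit i u) j = bit v j then 1 else -1 :: complex) =
        (\<Prod>j\<in>s - {i}. if bit u j = bit v j then 1 else -1)"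
    by (rule prod.cong) (auto simp: bit_flip_bit_nat)
  thus ?thesis
    unfolding cube_character_def prod.remove[OF assms True] rest
    using True by (cases "bit u i = bit v i") (simp_all add: bit_flip_bit_nat)
next
  case False
  thus ?thesis
    unfolding cube_character_def by (auto simp: bit_flip_bit_nat intro!: prod.cong)
qed

text \<open>The eigenvalue equation of the cube: of the \<open>n\<close> flips, the
  \<open>card s\<close> flips inside \<open>s\<close> negate the character and the others fix
  it.\<close>

lemma sum_cube_character_flip_bit:
  assumes "s \<subseteq> {..<n}"
  shows "(\<Sum>i<n. cube_character (flip_bit i u) s v) =
           (of_nat n - 2 * of_nat (card s)) * cube_character u s v"
proof -
  have fin: "finite s" using assms finite_subset by blast
  have "(\<Sum>i<n. (if i \<in> s then -1 else 1 :: complex)) = (\<Sum>i<n. 1 - 2 * (if i \<in> s then 1 else 0))"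
    by (rule sum.cong) auto
  also have "\<dots> = of_nat n - 2 * of_nat (card s)"
    using assms by (simp add: sum_subtractf Int_absorb1 flip: sum_distrib_left sum.inter_restrict)
  finally show ?thesis
    by (simp add: cube_character_flip_bit[OF fin] flip: sum_distrib_right)
qed

lemma prod_of_bool:
  fixes c :: "'a::comm_semiring_1"
  assumes "finite A"
  shows "(\<Prod>i\<in>A. if P i then c else 0) = (if \<forall>i\<in>A. P i then c ^ card A else 0)"
  using assms by (auto intro!: prod_zero)

text \<open>The sum over subsets is the expansion of a product over coordinates with factors
  \<open>1 + 1\<close> or \<open>-1 + 1\<close>; one differing coordinate makes it vanish. This is
  the character expansion of a unit vector.\<close>

lemma sum_cube_character:
  assumes "u < 2 ^ n" "v < 2 ^ n"
  shows "(\<Sum>s\<in>Pow {..<n}. cube_character u s v) = (if u = v then 2 ^ n else 0)"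
proof -
  have "(\<Sum>s\<in>Pow {..<n}. cube_character u s v) =
        (\<Prod>i<n. (if bit u i = bit v i then 1 else -1) + 1 :: complex)"
    by (subst prod_add) (auto simp: cube_character_def)
  also have "\<dots> = (\<Prod>i<n. if bit u i = bit v i then 2 else 0)"
    by (rule prod.cong) auto
  finally show ?thesis
    using nat_eq_iff_bit_lessThan[OF assms] by (auto simp: prod_of_bool)
qed

text \<open>The sign is absorbed by negating each factor of the character, so now it is an agreeing
  coordinate that makes the product vanish.\<close>

lemma sum_cube_character_alternating:
  "(\<Sum>s\<in>Pow {..<n}. (-1) ^ card s * cube_character u s v) = (if antipodal n u v then 2 ^ n else 0)"
proof -
  have "(\<Sum>s\<in>Pow {..<n}. (-1) ^ card s * cube_character u s v) =
        (\<Prod>i<n. - (if bit u i = bit v i then 1 else -1) + 1 :: complex)"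
    by (subst prod_add) (auto simp: cube_character_def prod_uminus)
  also have "\<dots> = (\<Prod>i<n. if bit u i \<noteq> bit v i then 2 else 0)"
    by (rule prod.cong) auto
  finally show ?thesis
    by (auto simp: prod_of_bool antipodal_def)
qed

text \<open>Spectral decomposition of the powers. The induction varies \<open>u\<close>, because the
  last factor of the power moves \<open>u\<close> to its bit flips; summing the characters over
  these flips produces one more eigenvalue factor.\<close>

lemma smult_cube_matrix_pow_entry:
  assumes "u < 2 ^ n" "v < 2 ^ n"
  shows "((c \<cdot>\<^sub>m cube_matrix n) ^\<^sub>m k) $$ (v, u) =
     (\<Sum>s\<in>Pow {..<n}. (c * (of_nat n - 2 * of_nat (card s))) ^ k * cube_character u s v) / 2 ^ n"
  using assms
proof (induction k arbitrary: u)
  case 0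
  thus ?case using sum_cube_character[OF 0] by (auto simp: adjacency_matrix_def)
next
  case (Suc k)
  let ?C = "c \<cdot>\<^sub>m cube_matrix n"
  let ?l = "\<lambda>s. of_nat n - 2 * of_nat (card s) :: complex"
  have C: "?C \<in> carrier_mat (2 ^ n) (2 ^ n)" by simp
  have "(?C ^\<^sub>m Suc k) $$ (v, u) = (\<Sum>w<2 ^ n. (?C ^\<^sub>m k) $$ (v, w) * ?C $$ (w, u))"
    using Suc.prems pow_carrier_mat[OF C, of k]
    by (simp, subst index_mult_mat_sum) (auto simp: adjacency_matrix_def)
  also have "\<dots> = (\<Sum>w<2 ^ n. c * (?C ^\<^sub>m k) $$ (v, w) * cube_matrix n $$ (w, u))"
    using Suc.prems by (intro sum.cong) (auto simp: adjacency_matrix_def)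
  also have "\<dots> = (\<Sum>i<n. c * (?C ^\<^sub>m k) $$ (v, flip_bit i u))"
    by (rule cube_matrix_sum_col) fact
  also have "\<dots> = (\<Sum>i<n. \<Sum>s\<in>Pow {..<n}.
      c * (c * ?l s) ^ k * cube_character (flip_bit i u) s v / 2 ^ n)"
    using Suc.prems
    by (intro sum.cong) (auto simp: Suc.IH flip_bit_less_power2 sum_distrib_left sum_divide_distrib mult.assoc)
  also have "\<dots> = (\<Sum>s\<in>Pow {..<n}.
      c * (c * ?l s) ^ k * (\<Sum>i<n. cube_character (flip_bit i u) s v) / 2 ^ n)"
    by (subst sum.swap) (simp add: sum_distrib_left sum_divide_distrib)
  also have "\<dots> = (\<Sum>s\<in>Pow {..<n}. (c * ?l s) ^ Suc k * cube_character u s v / 2 ^ n)"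
    by (intro sum.cong) (auto simp: sum_cube_character_flip_bit)
  finally show ?case by (simp add: sum_divide_distrib)
qed

text \<open>A finite combination of scalar exponential series, one for each character; stated with
  \<open>sums\<close> to provide convergence as well as the value.\<close>

lemma cube_matrix_exp_sums:
  assumes "u < 2 ^ n" "v < 2 ^ n"
  shows "(\<lambda>k. ((c \<cdot>\<^sub>m cube_matrix n) ^\<^sub>m k) $$ (v, u) / fact k) sums
     ((\<Sum>s\<in>Pow {..<n}. exp (c * (of_nat n - 2 * of_nat (card s))) * cube_character u s v) / 2 ^ n)"
proof -
  have "(\<lambda>k. (\<Sum>s\<in>Pow {..<n}. (c * (of_nat n - 2 * of_nat (card s))) ^ k /\<^sub>R fact k
            * cube_character u s v) / 2 ^ n) sums
     ((\<Sum>s\<in>Pow {..<n}. exp (c * (of_nat n - 2 * of_nat (card s))) * cube_character u s v) / 2 ^ n)"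
    by (intro sums_divide sums_sum sums_mult2 exp_converges)
  thus ?thesis
    by (simp add: smult_cube_matrix_pow_entry[OF assms] scaleR_conv_of_real sum_divide_distrib field_simps)
qed

text \<open>The exponent is \<open>n\<close> times \<open>-i pi/2\<close> plus \<open>m\<close>
  times \<open>i pi\<close>, and these exponentiate to \<open>-i\<close> and
  \<open>-1\<close>.\<close>

lemma exp_half_pi_eigenvalue:
  "exp (- \<i> * complex_of_real (pi / 2) * (of_nat n - 2 * of_nat m)) = (- \<i>) ^ n * (-1) ^ m"
proof -
  have "- \<i> * complex_of_real (pi / 2) * (of_nat n - 2 * of_nat m) =
        of_nat n * (- (\<i> * complex_of_real (pi / 2))) + of_nat m * (\<i> * complex_of_real pi)"
    by (simp add: algebra_simps)
  moreover have "exp (- (\<i> * complex_of_real (pi / 2))) = - \<i>"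
    by (simp add: exp_minus exp_eq_polar flip: cis_conv_exp)
  moreover have "exp (\<i> * complex_of_real pi) = -1" by (simp flip: cis_conv_exp)
  ultimately show ?thesis by (simp only: exp_add exp_of_nat_mult)
qed

lemma cube_transition_half_pi_sums:
  assumes "u < 2 ^ n" "v < 2 ^ n"
  shows "(\<lambda>k. (((- \<i> * complex_of_real (pi / 2)) \<cdot>\<^sub>m cube_matrix n) ^\<^sub>m k) $$ (v, u) / fact k)
           sums (if antipodal n u v then (- \<i>) ^ n else 0)"
proof -
  have "(\<Sum>s\<in>Pow {..<n}. exp (- \<i> * complex_of_real (pi / 2) * (of_nat n - 2 * of_nat (card s)))
            * cube_character u s v) / 2 ^ n
        = (- \<i>) ^ n * (\<Sum>s\<in>Pow {..<n}. (-1) ^ card s * cube_character u s v) / 2 ^ n"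
    unfolding exp_half_pi_eigenvalue by (simp add: sum_distrib_left mult.assoc)
  also have "\<dots> = (if antipodal n u v then (- \<i>) ^ n else 0)"
    by (simp add: sum_cube_character_alternating)
  finally show ?thesis using cube_matrix_exp_sums[OF assms, of "- \<i> * complex_of_real (pi / 2)"]
    by (simp only:)
qed

section \<open>The distance partition of the hypercube\<close>

text \<open>The number of differing coordinates; it is shown below to be the graph distance of the
  cube.\<close>

definition hamming_dist :: "nat \<Rightarrow> nat \<Rightarrow> nat \<Rightarrow> nat" where
  "hamming_dist n u v = card {i. i < n \<and> bit u i \<noteq> bit v i}"

lemma hamming_dist_le: "hamming_dist n u v \<le> n"
proof -
  have "hamming_dist n u v \<le> card {..<n}"
    unfolding hamming_dist_def by (rule card_mono) auto
  thus ?thesis by simp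
qed

lemma hamming_dist_eq_0_iff:
  assumes "u < 2 ^ n" "v < 2 ^ n"
  shows "hamming_dist n u v = 0 \<longleftrightarrow> v = u"
  using nat_eq_iff_bit_lessThan[OF assms] by (auto simp: hamming_dist_def)

lemma hamming_dist_eq_n_iff: "hamming_dist n u v = n \<longleftrightarrow> antipodal n u v"
proof
  assume "hamming_dist n u v = n"
  hence "card {i. i < n \<and> bit u i \<noteq> bit v i} = card {..<n}"
    by (simp only: hamming_dist_def card_lessThan)
  hence "{i. i < n \<and> bit u i \<noteq> bit v i} = {..<n}"
    by (intro card_subset_eq) auto
  thus "antipodal n u v" unfolding antipodal_def by blast
next
  assume "antipodal n u v"
  hence "{i. i < n \<and> bit u i \<noteq> bit v i} = {..<n}" unfolding antipodal_def by blast
  thus "hamming_dist n u v = n" by (simp only: hamming_dist_def card_lessThan)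
qed

text \<open>Flipping bit \<open>i\<close> removes \<open>i\<close> from, or adds it to, the set of
  differing coordinates. Positivity makes the truncated subtraction a genuine one.\<close>

lemma hamming_dist_flip_bit:
  assumes "i < n"
  shows "hamming_dist n u (flip_bit i v) =
    (if bit u i \<noteq> bit v i then hamming_dist n u v - 1 else Suc (hamming_dist n u v))"
    and "bit u i \<noteq> bit v i \<Longrightarrow> hamming_dist n u v > 0"
proof -
  let ?D = "{i. i < n \<and> bit u i \<noteq> bit v i}"
  have "{j. j < n \<and> bit u j \<noteq> bit (flip_bit i v) j} =
      (if bit u i \<noteq> bit v i then ?D - {i} else insert i ?D)"
    using assms by (auto simp: bit_flip_bit_nat split: if_splits)
  thus "hamming_dist n u (flip_bit i v) =
    (if bit u i \<noteq> bit v i then hamming_dist n u v - 1 else Suc (hamming_dist n u v))"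
    using assms by (auto simp: hamming_dist_def card_Diff_singleton)
  show "bit u i \<noteq> bit v i \<Longrightarrow> hamming_dist n u v > 0"
    using assms by (auto simp: hamming_dist_def card_gt_0_iff)
qed

text \<open>Flipping a coordinate of \<open>v\<close> that differs from \<open>u\<close> gives a
  neighbour of \<open>v\<close> one step closer to \<open>u\<close>; the walk to that neighbour is
  extended by one edge.\<close>

lemma cube_walk_hamming_dist:
  assumes "u < 2 ^ n" "v < 2 ^ n"
  shows "(u, v) \<in> cube_edges n ^^ hamming_dist n u v"
  using assms(2)
proof (induction "hamming_dist n u v" arbitrary: v)
  case 0
  hence "v = u" using hamming_dist_eq_0_iff[OF assms(1), of v] by simp
  thus ?case unfolding "0.hyps"[symmetric] by simp
next
  case (Suc k)
  then obtain i where i: "i < n" "bit u i \<noteq> bit v i"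
    unfolding hamming_dist_def by (metis (mono_tags, lifting) Collect_empty_eq card.empty nat.distinct(1))
  let ?w = "flip_bit i v"
  have w: "?w < 2 ^ n" using i Suc.prems by (simp add: flip_bit_less_power2)
  have "hamming_dist n u ?w = k" using hamming_dist_flip_bit(1)[OF i(1), of u v] i Suc.hyps(2) by simp
  hence "(u, ?w) \<in> cube_edges n ^^ k" using Suc.hyps(1) w by blast
  moreover have "(?w, v) \<in> cube_edges n"
    using cube_neighbours[OF Suc.prems] i cube_edges_sym by auto
  ultimately show ?case unfolding Suc.hyps(2)[symmetric] by auto
qed

text \<open>Each edge flips one bit and so raises the Hamming distance by at most one.\<close>

lemma hamming_dist_le_walk:
  assumes "u < 2 ^ n" "(u, v) \<in> cube_edges n ^^ k"
  shows "hamming_dist n u v \<le> k"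
  using assms(2)
proof (induction k arbitrary: v)
  case 0
  thus ?case by (simp add: hamming_dist_def)
next
  case (Suc k)
  then obtain w where w: "(u, w) \<in> cube_edges n ^^ k" "(w, v) \<in> cube_edges n" by auto
  hence "w < 2 ^ n" by (auto simp: cube_edges_def)
  with w(2) obtain i where "i < n" "v = flip_bit i w" using cube_neighbours by blast
  with Suc.IH[OF w(1)] show ?case by (auto simp: hamming_dist_flip_bit(1))
qed

lemma graph_dist_cube:
  assumes "u < 2 ^ n" "v < 2 ^ n"
  shows "graph_dist (cube_edges n) u v = hamming_dist n u v"
  unfolding graph_dist_def
  using cube_walk_hamming_dist[OF assms] hamming_dist_le_walk[OF assms(1)] by (intro Least_equality)

lemma length_cube_distance_partition [simp]: "length (cube_distance_partition n a) = Suc n"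
  by (simp add: cube_distance_partition_def)

lemma nth_cube_distance_partition:
  assumes "a < 2 ^ n" "j \<le> n"
  shows "cube_distance_partition n a ! j = {v. v < 2 ^ n \<and> hamming_dist n a v = j}"
proof -
  have "cube_distance_partition n a ! j = {v. v < 2 ^ n \<and> graph_dist (cube_edges n) a v = j}"
    using assms(2) unfolding cube_distance_partition_def by (subst nth_map) (auto simp del: upt_Suc)
  thus ?thesis using graph_dist_cube[OF assms(1)] by auto
qed

lemma exists_hamming_dist:
  assumes "a < 2 ^ n" "j \<le> n"
  shows "\<exists>v<2 ^ n. hamming_dist n a v = j"
proof -
  \<comment> \<open>Flips the lowest \<open>j\<close> bits of \<open>a\<close>.\<close>
  define v where "v = xor a (mask j :: nat)"
  have bit_v: "bit v i = (bit a i \<noteq> (i < j))" for i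
    by (simp add: v_def bit_xor_iff bit_mask_iff)
  have "v < 2 ^ n"
    using assms by (auto simp: nat_less_power2_iff_bit bit_v)
  moreover have "{i. i < n \<and> bit a i \<noteq> bit v i} = {..<j}"
    using assms by (auto simp: bit_v)
  ultimately show ?thesis by (auto simp: hamming_dist_def)
qed

text \<open>Levels of different distance are disjoint; since none is empty, they are also different
  as sets, which gives \<open>distinct\<close>.\<close>

lemma is_ordered_partition_cube_distance_partition:
  assumes "a < 2 ^ n"
  shows "is_ordered_partition (2 ^ n) (cube_distance_partition n a)"
proof -
  let ?V = "cube_distance_partition n a"
  have set_V: "set ?V = (\<lambda>j. {v. v < 2 ^ n \<and> hamming_dist n a v = j}) ` {..n}"
    using nth_cube_distance_partition[OF assms]
    by (auto simp: set_conv_nth image_iff less_Suc_eq_le)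
  have "distinct ?V"
  proof (subst distinct_conv_nth, intro allI impI notI)
    fix i j assume ij: "i < length ?V" "j < length ?V" "i \<noteq> j" "?V ! i = ?V ! j"
    then obtain v where "v < 2 ^ n" "hamming_dist n a v = i"
      using exists_hamming_dist[OF assms, of i] by auto
    hence "v \<in> ?V ! i" using ij(1) by (simp add: nth_cube_distance_partition[OF assms])
    hence "v \<in> ?V ! j" using ij(4) by simp
    thus False
      using ij(2,3) \<open>hamming_dist n a v = i\<close> by (simp add: nth_cube_distance_partition[OF assms])
  qed
  moreover have "partition_on {..<2 ^ n} (set ?V)"
    unfolding set_V partition_on_def disjoint_def
  proof (intro conjI)
    let ?L = "\<lambda>j. {v. v < 2 ^ n \<and> hamming_dist n a v = j}"
    show "\<Union> (?L ` {..n}) = {..<2 ^ n}"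
      using hamming_dist_le by auto
    show "\<forall>U\<in>?L ` {..n}. \<forall>U'\<in>?L ` {..n}. U \<noteq> U' \<longrightarrow> U \<inter> U' = {}"
      by auto
    show "{} \<notin> ?L ` {..n}"
    proof
      assume "{} \<in> ?L ` {..n}"
      then obtain j where "j \<le> n" "?L j = {}" by auto
      thus False using exists_hamming_dist[OF assms, of j] by blast
    qed
  qed
  ultimately show ?thesis by (simp add: is_ordered_partition_def)
qed

lemma cube_distance_partition_first:
  assumes "a < 2 ^ n"
  shows "cube_distance_partition n a ! 0 = {a}"
  using assms hamming_dist_eq_0_iff[OF assms] by (auto simp: nth_cube_distance_partition)

lemma antipodal_unique:
  assumes "antipodal n u v" "antipodal n u w" "v < 2 ^ n" "w < 2 ^ n"
  shows "v = w"
  using assms nat_eq_iff_bit_lessThan[OF assms(3,4)] by (auto simp: antipodal_def)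

lemma cube_distance_partition_last:
  assumes "a < 2 ^ n" "b < 2 ^ n" "antipodal n a b"
  shows "cube_distance_partition n a ! n = {b}"
proof -
  have "cube_distance_partition n a ! n = {v. v < 2 ^ n \<and> antipodal n a v}"
    using nth_cube_distance_partition[OF assms(1), of n] by (simp add: hamming_dist_eq_n_iff)
  thus ?thesis using assms antipodal_unique[OF assms(3) _ assms(2)] by blast
qed

section \<open>The quotient of the cube by its distance partition\<close>

text \<open>The intersection numbers of the cube: how many neighbours in level \<open>j\<close> a
  vertex of level \<open>k\<close> has.\<close>

definition cube_quotient_degree :: "nat \<Rightarrow> nat \<Rightarrow> nat \<Rightarrow> nat" where
  "cube_quotient_degree n k j = (if Suc j = k then k else if j = Suc k then n - k else 0)"

text \<open>Flipping one of the coordinates where \<open>v\<close> differs from \<open>a\<close>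
  leads one level down, flipping any other leads one level up; hence the count depends on
  \<open>v\<close> only through its level.\<close>

lemma cube_distance_partition_equitable:
  "(\<Sum>i<n. if hamming_dist n a (flip_bit i v) = j then 1 else 0 :: complex) =
     of_nat (cube_quotient_degree n (hamming_dist n a v) j)"
proof -
  let ?k = "hamming_dist n a v"
  let ?D = "{i. i < n \<and> bit a i \<noteq> bit v i}"
  have "(\<Sum>i<n. if hamming_dist n a (flip_bit i v) = j then 1 else 0 :: complex) =
        of_nat (card {i\<in>{..<n}. hamming_dist n a (flip_bit i v) = j})"
    by (simp add: sum.If_cases Int_def)
  also have "{i\<in>{..<n}. hamming_dist n a (flip_bit i v) = j} =
      (if Suc j = ?k then ?D else if j = Suc ?k then {..<n} - ?D else {})"
    using hamming_dist_flip_bit[of _ n a v] by (auto split: if_splits) 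
  also have "card \<dots> = cube_quotient_degree n ?k j"
  proof -
    have "card ({..<n} - ?D) = n - card ?D" by (subst card_Diff_subset) auto
    thus ?thesis by (simp add: cube_quotient_degree_def hamming_dist_def)
  qed
  finally show ?thesis .
qed

text \<open>Equitability gives \<open>A P = P X\<close> for an explicit \<open>X\<close>.
  Orthonormality of the columns of \<open>P\<close> then turns the defining product into
  \<open>X\<close> itself.\<close>

lemma cube_symmetrized_divisor_matrix:
  assumes a: "a < 2 ^ n"
  defines "P \<equiv> normalized_indicator_matrix (2 ^ n) (cube_distance_partition n a)"
  shows "cube_symmetrized_divisor_matrix n a \<in> carrier_mat (Suc n) (Suc n)"
    and "cube_matrix n * P = P * cube_symmetrized_divisor_matrix n a"
proof -
  let ?V = "cube_distance_partition n a" and ?A = "cube_matrix n"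
  note V = is_ordered_partition_cube_distance_partition[OF a]
  have P: "P \<in> carrier_mat (2 ^ n) (Suc n)"
    unfolding P_def using normalized_indicator_matrix_carrier[of "2 ^ n" ?V] by simp
  define c where "c j = complex_of_real (sqrt (real (card (?V ! j))))" for j
  \<comment> \<open>The quotient matrix rescaled to normalized columns: \<open>c j\<close>
    normalizes column \<open>j\<close> of \<open>P\<close>, and \<open>c k\<close> cancels the entry
    of \<open>P\<close> in a row of level \<open>k\<close>.\<close>
  define X where "X = mat (Suc n) (Suc n) (\<lambda>(k, j). c k / c j * of_nat (cube_quotient_degree n k j))"
  have X: "X \<in> carrier_mat (Suc n) (Suc n)" by (simp add: X_def)
  have AP: "?A * P = P * X"
  proof (rule eq_matI)
    fix v j assume "v < dim_row (P * X)" "j < dim_col (P * X)"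
    hence vj: "v < 2 ^ n" "j < Suc n" using P X by auto
    define k where "k = hamming_dist n a v"
    have k: "k < Suc n" unfolding k_def by (simp add: less_Suc_eq_le hamming_dist_le)
    have vk: "v \<in> ?V ! k" using vj k by (simp add: nth_cube_distance_partition[OF a] k_def)
    have "(?A * P) $$ (v, j) = (\<Sum>w<2 ^ n. ?A $$ (v, w) * P $$ (w, j))"
      using vj P by (subst index_mult_mat_sum) (auto simp: adjacency_matrix_def)
    also have "\<dots> = (\<Sum>i<n. P $$ (flip_bit i v, j))"
      by (rule cube_matrix_sum_row[OF vj(1)])
    also have "\<dots> = (\<Sum>i<n. (if hamming_dist n a (flip_bit i v) = j then 1 else 0) / c j)"
      using vj unfolding P_def c_def
      by (intro sum.cong)
        (auto simp: normalized_indicator_matrix_def nth_cube_distance_partition[OF a] flip_bit_less_power2)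
    also have "\<dots> = of_nat (cube_quotient_degree n k j) / c j"
      by (simp add: cube_distance_partition_equitable k_def flip: sum_divide_distrib)
    also have "\<dots> = X $$ (k, j) / c k"
      using vj k ordered_partition_part(3)[OF V, of k] by (simp add: X_def c_def)
    also have "\<dots> = (P * X) $$ (v, j)"
      unfolding P_def c_def using vj k vk X
      by (subst normalized_indicator_matrix_mult_row[OF V, of k]) auto
    finally show "(?A * P) $$ (v, j) = (P * X) $$ (v, j)" .
  qed (use P X in \<open>auto simp: adjacency_matrix_def\<close>)
  have "cube_symmetrized_divisor_matrix n a = transpose_mat P * ?A * P"
    by (simp add: cube_symmetrized_divisor_matrix_def P_def Let_def)
  also have "\<dots> = transpose_mat P * (P * X)"
    unfolding AP[symmetric] using P by (intro assoc_mult_mat[of _ "Suc n" "2 ^ n" _ "2 ^ n" _ "Suc n"]) auto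
  also have "\<dots> = (transpose_mat P * P) * X"
    using P X by (intro assoc_mult_mat[symmetric, of _ "Suc n" "2 ^ n" _ "Suc n" _ "Suc n"]) auto
  also have "\<dots> = X"
    using X normalized_indicator_matrix_orthonormal[OF V] by (simp add: P_def)
  finally have "cube_symmetrized_divisor_matrix n a = X" .
  with X AP show "cube_symmetrized_divisor_matrix n a \<in> carrier_mat (Suc n) (Suc n)"
    "?A * P = P * cube_symmetrized_divisor_matrix n a" by simp_all
qed

section \<open>Comparison of the cube with an arbitrary matrix of the same quotient\<close>

lemma mat_mult_unit_vec_eqI:
  fixes M :: "complex mat"
  assumes "M \<in> carrier_mat m m" "x < m" "y < m" "\<And>u. u < m \<Longrightarrow> M $$ (u, x) = (if u = y then g else 0)"
  shows "M *\<^sub>v unit_vec m x = g \<cdot>\<^sub>v unit_vec m y"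
  using assms by (intro eq_vecI) auto

theorem mainTheorem9:
  fixes n m a b a' b' :: nat
    and A' :: "complex mat"
    and W :: "nat set list"
  assumes "n \<ge> 1"
    and "a < 2 ^ n" and "b < 2 ^ n" and "antipodal n a b"
    and "A' \<in> carrier_mat m m"
    and "is_ordered_partition m W" and "length W = Suc n"
    and "A' * normalized_indicator_matrix m W =
         normalized_indicator_matrix m W * cube_symmetrized_divisor_matrix n a"
    and "W ! 0 = {a'}" and "W ! n = {b'}"
  shows "rational_reduction [a, b] (cube_matrix n) = rational_reduction [a', b'] A'
    \<and> (\<forall>t. block (transition_matrix (cube_matrix n) t) [a, b] [a, b] =
           block (transition_matrix A' t) [a', b'] [a', b'])
    \<and> perfect_state_transfer A' a' b' (pi / 2)"
proof -
  let ?A = "cube_matrix n" and ?V = "cube_distance_partition n a"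
  let ?d = "cube_symmetrized_divisor_matrix n a"
  note A' = \<open>A' \<in> carrier_mat m m\<close> and W = \<open>is_ordered_partition m W\<close> and lenW = \<open>length W = Suc n\<close>
  note V = is_ordered_partition_cube_distance_partition[OF \<open>a < 2 ^ n\<close>]
  note d = cube_symmetrized_divisor_matrix(1)[OF \<open>a < 2 ^ n\<close>]
  note AP = cube_symmetrized_divisor_matrix(2)[OF \<open>a < 2 ^ n\<close>]
  have V_ends: "?V ! 0 = {a}" "?V ! n = {b}"
    using cube_distance_partition_first cube_distance_partition_last assms by auto
  have lt: "a' < m" "b' < m"
    using ordered_partition_part(1)[OF W, of 0] ordered_partition_part(1)[OF W, of n] assms by auto
  have ba: "antipodal n b a" using \<open>antipodal n a b\<close> by (auto simp: antipodal_def)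

  \<comment> \<open>Both reductions are compared with that of \<open>?d\<close> at
    \<open>[0, n]\<close>, the positions of the two singleton parts.\<close>
  have red: "rational_reduction [x, y] B = rational_reduction [0, n] ?d"
    if B: "B \<in> carrier_mat N N" and Vs: "is_ordered_partition N Vs" "length Vs = Suc n"
      and BP: "B * normalized_indicator_matrix N Vs = normalized_indicator_matrix N Vs * ?d"
      and ends: "Vs ! 0 = {x}" "Vs ! n = {y}" for N B Vs x y
  proof (rule rational_reduction_intertwine[OF B d _ BP])
    \<comment> \<open>As \<open>n \<ge> 1\<close>, the positions 0 and \<open>n\<close> are
      different parts.\<close>
    have "x \<noteq> y"
      using ordered_partition_cell_unique[OF Vs(1), of 0 n x] Vs(2) ends \<open>n \<ge> 1\<close> by auto
    thus "distinct [x, y]" by simp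
    show "set [x, y] \<subseteq> {..<N}"
      using ordered_partition_part(1)[OF Vs(1), of 0] ordered_partition_part(1)[OF Vs(1), of n] Vs(2) ends
      by auto
    show "normalized_indicator_matrix N Vs $$ ([x, y] ! i, j) = (if j = [0, n] ! i then 1 else 0)"
      if "i < length [x, y]" "j < Suc n" for i j
      using that ends Vs(2) normalized_indicator_matrix_row[OF Vs(1), of 0 j x]
        normalized_indicator_matrix_row[OF Vs(1), of n j y]
      by (auto simp: less_Suc_eq)
    show "normalized_indicator_matrix N Vs $$ (u, [0, n] ! i) = (if u = [x, y] ! i then 1 else 0)"
      if "i < length [x, y]" "u < N" for i u
      using that ends Vs(2) \<open>n \<ge> 1\<close> normalized_indicator_matrix_singleton_col[of Vs 0 x u N]
        normalized_indicator_matrix_singleton_col[of Vs n y u N]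
      by (auto simp: less_Suc_eq)
    show "normalized_indicator_matrix N Vs \<in> carrier_mat N (Suc n)"
      using normalized_indicator_matrix_carrier[of N Vs] unfolding Vs(2) .
  qed (use \<open>n \<ge> 1\<close> in auto)
  have "rational_reduction [a, b] ?A = rational_reduction [a', b'] A'"
    using red[OF cube_matrix_carrier V _ AP V_ends] red[OF A' W lenW assms(8-10)] by simp

  moreover have "block (transition_matrix ?A t) [a, b] [a, b] =
      block (transition_matrix A' t) [a', b'] [a', b']" for t
  proof -
    \<comment> \<open>Rows and columns both belong to singleton parts, so the sizes agree and the
      scaling factor is 1.\<close>
    have tr: "transition_matrix A' t $$ (u', x') = transition_matrix ?A t $$ (u, x)"
      if "(i, u, u') \<in> {(0, a, a'), (n, b, b')}" "(j, x, x') \<in> {(0, a, a'), (n, b, b')}"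
      for i u u' j x x'
      using that V_ends lenW assms(9,10)
        transition_matrix_quotient_transfer[OF V cube_matrix_carrier AP W A' assms(8) d, of i u u' j x x' t]
      by auto
    show ?thesis
      unfolding block_def
      using tr[of 0 a a' 0 a a'] tr[of 0 a a' n b b'] tr[of n b b' 0 a a'] tr[of n b b' n b b']
      by (intro eq_matI) (auto simp: less_Suc_eq)
  qed

  moreover have "perfect_state_transfer A' a' b' (pi / 2)"
  proof -
    \<comment> \<open>The equation between the pairs leaves open which end is the source, so one
      argument covers both directions of the transfer.\<close>
    have transfer: "transition_matrix A' (pi / 2) *\<^sub>v unit_vec (dim_row A') x' =
        (- \<i>) ^ n \<cdot>\<^sub>v unit_vec (dim_row A') y'"
      if xy: "{(j, x, x'), (l, y, y')} = {(0, a, a'), (n, b, b')}" "antipodal n x y" for j x x' l y y'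
    proof -
      have j: "j \<le> n" "?V ! j = {x}" "W ! j = {x'}" "x < 2 ^ n" "x' < m"
        and l: "l \<le> n" "?V ! l = {y}" "W ! l = {y'}" "y < 2 ^ n" "y' < m"
        using xy(1) V_ends assms lt by (auto simp: doubleton_eq_iff)
      have entry: "transition_matrix A' (pi / 2) $$ (u', x') = (if u' = y' then (- \<i>) ^ n else 0)"
        if u': "u' < m" for u'
      proof -
        obtain i where i: "i < Suc n" "u' \<in> W ! i"
          using ordered_partition_cell[OF W u'] lenW by auto
        \<comment> \<open>Any cube vertex of the level corresponding to the part of
          \<open>u'\<close> serves for comparison.\<close>
        obtain u where u: "u \<in> ?V ! i"
          using ordered_partition_part(3)[OF V, of i] i by (auto simp: card_gt_0_iff)
        have u_lt: "u < 2 ^ n" using ordered_partition_part(1)[OF V, of i] i u by auto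
        \<comment> \<open>Away from the ends, parts of \<open>W\<close> may differ in size from the
          levels of the cube, so the transfer requires convergence.\<close>
        note sums = cube_transition_half_pi_sums[OF j(4) u_lt]
        have "transition_matrix ?A (pi / 2) $$ (u, x) = (if antipodal n x u then (- \<i>) ^ n else 0)"
          using sums_unique[OF sums] by (simp only: transition_matrix_entry[OF cube_matrix_carrier u_lt j(4)])
        moreover have "antipodal n x u \<longleftrightarrow> u = y"
          using antipodal_unique[OF xy(2) _ l(4) u_lt] xy(2) by blast
        moreover have "u = y \<longleftrightarrow> i = l"
          using ordered_partition_cell_unique[OF V, of i l y] u i l by auto
        moreover have "u' = y' \<longleftrightarrow> i = l"
          using ordered_partition_cell_unique[OF W, of i l y'] i l lenW by auto
        \<comment> \<open>At \<open>u' = y'\<close> both parts are singletons and the scaling factor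
          is 1; elsewhere the entry of the cube is 0 and stays 0 after scaling.\<close>
        ultimately show ?thesis
          using transition_matrix_quotient_transfer[OF V cube_matrix_carrier AP W A' assms(8) d,
              of i u u' j x x' "pi / 2"] i u j l lenW sums_summable[OF sums]
          by auto
      qed
      thus ?thesis
        using A' by (auto intro!: mat_mult_unit_vec_eqI j(5) l(5))
    qed
    have "cmod ((- \<i>) ^ n) = 1" by (simp add: norm_power)
    thus ?thesis
      unfolding perfect_state_transfer_def
      using transfer[of 0 a a' n b b'] transfer[of n b b' 0 a a'] ba \<open>antipodal n a b\<close> by auto
  qed
  ultimately show ?thesis by blast
qed

end
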